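(* A $*$-product on a $\mathbb{K}$-vector space $A$ is the same as an $LL_{t^2}$-algebra structure on the $\mathbb{K}[[t]]$-module $V := A[[t]]$.
   Context: $\mathbb{K}$ is a field of characteristic $0$, and the ground ring is the ring $\mathbb{K}[[t]]$ of formal power series in $t$; $A[[t]]$ denotes the $\mathbb{K}[[t]]$-module of formal power series in $t$ with coefficients in $A$. A $*$-product on a $\mathbb{K}$-vector space $A$ is a $\mathbb{K}[[t]]$-linear associative unital multiplication $* : A[[t]]\otimes A[[t]]\to A[[t]]$ which is commutative mod $t$. For a parameter $q$, an $LL_q$-algebra is a structure with a commutative bilinear multiplication $\bullet$ (written $xy := x\bullet y$) and an anticommutative bilinear operation $[-,-]$ satisfying, for all elements $x,y,z$, $$[x,[y,z]]+[y,[z,x]]+[z,[x,y]]=0,$$ $$[x,yz]=[x,y]z+y[x,z],$$ $$(xy)z-x(yz)=q\,[y,[x,z]].$$ Here these axioms are taken over the ground ring $\mathbb{K}[[t]]$ with $q=t^2$.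
   Formalization: The LL-axioms do not force a unit (zero operations are a counterexample), so unital *-products are matched with LL-structures whose commutative product has a unit; all LL-structures are matched with *-products without the unit requirement, and units are shown to agree. *)

theory Defs
  imports "HOL-Computational_Algebra.Formal_Power_Series"
begin

text \<open>
  For a vector space \<open>A\<close> over \<open>K\<close>, given by \<open>scale\<close>, the type \<open>'a fps\<close> is \<open>A[[t]]\<close>.
  The library does not make it a module over \<open>K[[t]]\<close>; the action is the Cauchy product.
\<close>

definition fps_scale ::
    "('k::field \<Rightarrow> 'a::ab_group_add \<Rightarrow> 'a) \<Rightarrow> 'k fps \<Rightarrow> 'a fps \<Rightarrow> 'a fps" where
  "fps_scale scale f v =
     Abs_fps (\<lambda>n. \<Sum>i=0..n. scale (fps_nth f i) (fps_nth v (n - i)))"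

lemma module_fps_scale:
  assumes "vector_space scale"
  shows "module (fps_scale scale)"
proof -
  interpret vector_space scale by fact
  show ?thesis
  proof
    fix a b :: "'a fps" and x y :: "'b fps"
    show "fps_scale scale a (x + y) = fps_scale scale a x + fps_scale scale a y"
      by (rule fps_ext) (simp add: fps_scale_def scale_right_distrib sum.distrib)
    show "fps_scale scale (a + b) x = fps_scale scale a x + fps_scale scale b x"
      by (rule fps_ext) (simp add: fps_scale_def scale_left_distrib sum.distrib)
    show "fps_scale scale a (fps_scale scale b x) = fps_scale scale (a * b) x"
    proof (rule fps_ext)
      fix n :: nat
      have "(\<Sum>j=0..n. \<Sum>i=0..j.
              scale (fps_nth a i * fps_nth b (j - i)) (fps_nth x (n - j))) =
            (\<Sum>j=0..n. \<Sum>i=0..n - j.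
              scale (fps_nth a j * fps_nth b i) (fps_nth x (n - j - i)))"
        by (rule fps_mult_assoc_lemma)
      then show "fps_nth (fps_scale scale a (fps_scale scale b x)) n =
                 fps_nth (fps_scale scale (a * b) x) n"
        by (simp add: fps_scale_def fps_mult_nth scale_sum_left scale_sum_right)
    qed
    show "fps_scale scale 1 x = x"
    proof (rule fps_ext)
      fix n :: nat
      have "(\<Sum>i=0..n. scale (fps_nth 1 i) (fps_nth x (n - i))) =
            (\<Sum>i=0..n. if i = 0 then fps_nth x n else 0)"
        by (rule sum.cong) auto
      then show "fps_nth (fps_scale scale 1 x) n = fps_nth x n"
        by (simp add: fps_scale_def)
    qed
  qed
qed

definition module_bilinear ::
    "('r::comm_ring_1 \<Rightarrow> 'v::ab_group_add \<Rightarrow> 'v) \<Rightarrow> ('v \<Rightarrow> 'v \<Rightarrow> 'v) \<Rightarrow> bool" where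
  "module_bilinear scl f \<longleftrightarrow>
     (\<forall>x. module_hom scl scl (\<lambda>y. f x y)) \<and> (\<forall>y. module_hom scl scl (\<lambda>x. f x y))"

definition is_unit_elem :: "('v \<Rightarrow> 'v \<Rightarrow> 'v) \<Rightarrow> 'v \<Rightarrow> bool" where
  "is_unit_elem f e \<longleftrightarrow> (\<forall>x. f e x = x \<and> f x e = x)"

text \<open>Linear maps out of the tensor square over \<open>K[[t]]\<close> are rendered as bilinear maps.\<close>

locale nonunital_star_product = vector_space scale
  for scale :: "'k::field_char_0 \<Rightarrow> 'a::ab_group_add \<Rightarrow> 'a" +
  fixes star :: "'a fps \<Rightarrow> 'a fps \<Rightarrow> 'a fps"
  assumes star_bilinear: "module_bilinear (fps_scale scale) star"
    and star_assoc: "star (star x y) z = star x (star y z)"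
    and star_commute_mod_t: "\<exists>w. star x y - star y x = fps_scale scale fps_X w"

locale star_product = nonunital_star_product +
  assumes star_unital: "\<exists>e. is_unit_elem star e"

locale LL_algebra = module scl
  for scl :: "'r::comm_ring_1 \<Rightarrow> 'v::ab_group_add \<Rightarrow> 'v" +
  fixes q :: 'r
    and mul :: "'v \<Rightarrow> 'v \<Rightarrow> 'v"
    and brk :: "'v \<Rightarrow> 'v \<Rightarrow> 'v"
  assumes mul_bilinear: "module_bilinear scl mul"
    and brk_bilinear: "module_bilinear scl brk"
    and mul_commute: "mul x y = mul y x"
    and brk_anticommute: "brk x y = - brk y x"
    and jacobi: "brk x (brk y z) + brk y (brk z x) + brk z (brk x y) = 0"
    and leibniz: "brk x (mul y z) = mul (brk x y) z + mul y (brk x z)"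
    and associator: "mul (mul x y) z - mul x (mul y z) = scl q (brk y (brk x z))"

locale unital_LL_algebra = LL_algebra +
  assumes mul_unital: "\<exists>e. is_unit_elem mul e"

text \<open>
  The product \<open>x * y = x y + t [x, y]\<close>. In terms of \<open>*\<close> this means
  \<open>x y = (x * y + y * x) / 2\<close> and \<open>t [x, y] = (x * y - y * x) / 2\<close>.
\<close>

definition depolarize ::
    "('k::field \<Rightarrow> 'a::ab_group_add \<Rightarrow> 'a) \<Rightarrow>
     ('a fps \<Rightarrow> 'a fps \<Rightarrow> 'a fps) \<times> ('a fps \<Rightarrow> 'a fps \<Rightarrow> 'a fps) \<Rightarrow>
     'a fps \<Rightarrow> 'a fps \<Rightarrow> 'a fps" where
  "depolarize scale = (\<lambda>(mul, brk) x y. mul x y + fps_scale scale fps_X (brk x y))"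

end

theory Submission
  imports Defs
begin

text \<open>
  The correspondence is the polarization of a product into its symmetric and antisymmetric parts.
  Since \<open>2\<close> is invertible, a bilinear product \<open>*\<close> splits uniquely as \<open>x * y = x y + c x y\<close> with
  \<open>x y\<close> symmetric and \<open>c\<close> antisymmetric. Commutativity mod \<open>t\<close> says that \<open>c\<close> takes values in
  \<open>t V\<close>, and multiplication by \<open>t\<close> is injective on \<open>V = A[[t]]\<close>, so \<open>c x y = t [x, y]\<close> for exactly
  one operation \<open>[-,-]\<close>, which is again bilinear. Thus commutative products together with
  anticommutative brackets are the same as products that are commutative mod \<open>t\<close>.

  It remains to match the axioms. If the LL axioms hold, then the parts of the associator of \<open>*\<close>
  that carry an explicit factor \<open>1\<close>, \<open>t\<close>, \<open>t\<^sup>2\<close> are governed by the associator axiom, the Leibniz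
  rule and the Jacobi identity: the \<open>t\<close> part vanishes, and the other two cancel
  (\<open>polarized_product_assoc\<close>). Conversely, in an associative algebra the commutator satisfies the
  Jacobi identity, is a derivation of the symmetrized product, and
  expresses its associator; up to powers of \<open>2\<close>, these three identities are the LL axioms multiplied
  by \<open>t\<^sup>2\<close>, \<open>t\<close> and \<open>1\<close>, and the factors of \<open>t\<close> can be cancelled (\<open>LL_algebra_polarization\<close>).

  Units agree because a unit of the commutative product is central: by the Leibniz rule
  \<open>[x, e] = [x, e e] = 2 [x, e]\<close> (\<open>bracket_with_unit\<close>). Hence the unital correspondence is the
  restriction of the nonunital one.

  The argument rests on the injectivity of \<open>t\<close> and the invertibility of \<open>2\<close>; it is carried out
  for a module over an arbitrary commutative ring with these properties and then specialized to
  \<open>A[[t]]\<close>.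
\<close>

section \<open>Bilinear operations\<close>

definition commutator ::
    "('v::ab_group_add \<Rightarrow> 'v \<Rightarrow> 'v) \<Rightarrow> 'v \<Rightarrow> 'v \<Rightarrow> 'v" where
  "commutator f x y = f x y - f y x"

definition anticommutator ::
    "('v::ab_group_add \<Rightarrow> 'v \<Rightarrow> 'v) \<Rightarrow> 'v \<Rightarrow> 'v \<Rightarrow> 'v" where
  "anticommutator f x y = f x y + f y x"

lemma module_bilinear_iff:
  assumes "module scl"
  shows "module_bilinear scl f \<longleftrightarrow>
    (\<forall>x y z. f x (y + z) = f x y + f x z) \<and> (\<forall>x y z. f (x + y) z = f x z + f y z) \<and>
    (\<forall>r x y. f x (scl r y) = scl r (f x y)) \<and> (\<forall>r x y. f (scl r x) y = scl r (f x y))"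
  using assms
  by (auto simp: module_bilinear_def module_hom_def module_hom_axioms_def)

context module
begin

context
  fixes f :: "'b \<Rightarrow> 'b \<Rightarrow> 'b"
  assumes f: "module_bilinear scale f"
begin

lemma bilinear_add_right: "f x (y + z) = f x y + f x z"
  and bilinear_add_left: "f (x + y) z = f x z + f y z"
  and bilinear_scale_right: "f x (scale r y) = scale r (f x y)"
  and bilinear_scale_left: "f (scale r x) y = scale r (f x y)"
  using f module_bilinear_iff[OF module_axioms, of f] by blast+

lemma bilinear_diff_right: "f x (y - z) = f x y - f x z"
  using bilinear_add_right[of x "y - z" z] by (simp add: algebra_simps)

lemma bilinear_diff_left: "f (x - y) z = f x z - f y z"
  using bilinear_add_left[of "x - y" y z] by (simp add: algebra_simps)

lemma bilinear_minus_right: "f x (- y) = - f x y"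
  using bilinear_diff_right[of x y y] bilinear_diff_right[of x "y - y" y] by simp

lemma bilinear_minus_left: "f (- x) y = - f x y"
  using bilinear_diff_left[of x x y] bilinear_diff_left[of "x - x" x y] by simp

lemmas bilinear_simps =
  bilinear_add_right bilinear_add_left bilinear_diff_right bilinear_diff_left
  bilinear_minus_right bilinear_minus_left bilinear_scale_right bilinear_scale_left

end

lemma commutator_bilinear:
  assumes f: "module_bilinear scale f"
  shows "module_bilinear scale (commutator f)"
  unfolding module_bilinear_iff[OF module_axioms] commutator_def
  by (simp only: bilinear_simps[OF f] scale_right_diff_distrib add_diff_add simp_thms)

lemma anticommutator_bilinear:
  assumes f: "module_bilinear scale f"
  shows "module_bilinear scale (anticommutator f)"
  unfolding module_bilinear_iff[OF module_axioms] anticommutator_def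
  by (simp only: bilinear_simps[OF f] scale_right_distrib ac_simps simp_thms)

lemma scaled_bilinear:
  assumes f: "module_bilinear scale f"
  shows "module_bilinear scale (\<lambda>x y. scale r (f x y))"
  unfolding module_bilinear_iff[OF module_axioms]
  by (simp only: bilinear_simps[OF f] scale_right_distrib scale_left_commute[of r] simp_thms)

context
  fixes f :: "'b \<Rightarrow> 'b \<Rightarrow> 'b"
  assumes f: "module_bilinear scale f" and assoc: "\<And>x y z. f (f x y) z = f x (f y z)"
begin

text \<open>
  These three identities hold because, after expansion, both sides are the same signed sums of
  products of \<open>x\<close>, \<open>y\<close>, \<open>z\<close> in various orders. They are the sources of the Jacobi, Leibniz and
  associator axioms.
\<close>

lemma commutator_jacobi:
  "commutator f x (commutator f y z) + commutator f y (commutator f z x) +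
   commutator f z (commutator f x y) = 0"
  by (simp only: commutator_def bilinear_simps[OF f] assoc) (simp add: algebra_simps)

lemma commutator_derivation:
  "commutator f x (anticommutator f y z) =
   anticommutator f (commutator f x y) z + anticommutator f y (commutator f x z)"
  by (simp only: commutator_def anticommutator_def bilinear_simps[OF f] assoc)
    (simp add: algebra_simps)

lemma anticommutator_associator:
  "anticommutator f (anticommutator f x y) z - anticommutator f x (anticommutator f y z) =
   commutator f y (commutator f x z)"
  by (simp only: commutator_def anticommutator_def bilinear_simps[OF f] assoc)
    (simp add: algebra_simps)

end

end

section \<open>From LL-algebras to associative products\<close>

context LL_algebra
begin

lemmas mul_simps = bilinear_simps[OF mul_bilinear]
lemmas brk_simps = bilinear_simps[OF brk_bilinear]

text \<open>
  The associator of \<open>x y + t [x, y]\<close> is sorted by explicit powers of \<open>t\<close>. The part without \<open>t\<close>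
  is \<open>t\<^sup>2 [y, [x, z]]\<close> by the associator axiom, so it belongs to the \<open>t\<^sup>2\<close> part, where the Jacobi
  identity makes everything cancel; the \<open>t\<close> part vanishes by two instances of the Leibniz rule.
\<close>

lemma polarized_product_assoc:
  assumes q: "q = t ^ 2"
  defines "star \<equiv> \<lambda>x y. mul x y + scl t (brk x y)"
  shows "star (star x y) z = star x (star y z)"
proof -
  have zeroth: "mul (mul x y) z - mul x (mul y z) = scl t (scl t (brk y (brk x z)))"
    by (simp add: associator q power2_eq_square)
  have "brk (mul x y) z = mul (brk x z) y + mul x (brk y z)"
    using leibniz[of z x y] brk_anticommute[of "mul x y" z] brk_anticommute[of z x]
      brk_anticommute[of z y]
    by (simp add: mul_simps)
  then have first: "brk (mul x y) z + mul (brk x y) z - brk x (mul y z) - mul x (brk y z) = 0"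
    using leibniz[of x y z] mul_commute[of "brk x z" y] by simp
  have second: "brk y (brk x z) + brk (brk x y) z - brk x (brk y z) = 0"
  proof -
    have "brk y (brk z x) = - brk y (brk x z)"
      using brk_anticommute[of z x] by (simp add: brk_simps)
    moreover have "brk (brk x y) z = - brk z (brk x y)"
      by (rule brk_anticommute)
    ultimately show ?thesis
      using jacobi[of x y z] by (simp add: algebra_simps)
  qed
  have "star (star x y) z - star x (star y z) =
      (mul (mul x y) z - mul x (mul y z)) +
      scl t (brk (mul x y) z + mul (brk x y) z - brk x (mul y z) - mul x (brk y z)) +
      scl t (scl t (brk (brk x y) z - brk x (brk y z)))"
    by (simp add: star_def mul_simps brk_simps scale_right_distrib scale_right_diff_distrib
        del: scale_scale)
  also have "\<dots> = scl t (scl t (brk y (brk x z) + brk (brk x y) z - brk x (brk y z)))"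
    by (simp add: zeroth first scale_right_distrib scale_right_diff_distrib del: scale_scale)
  also have "\<dots> = 0"
    by (simp add: second)
  finally show ?thesis by simp
qed

text \<open>This is what makes the units of the two products agree: a derivation kills a unit.\<close>

lemma bracket_with_unit:
  assumes "is_unit_elem mul e"
  shows "brk x e = 0" and "brk e x = 0"
proof -
  have "brk x e = brk x e + brk x e"
    using leibniz[of x e e] assms by (simp add: is_unit_elem_def)
  then show "brk x e = 0" by simp
  then show "brk e x = 0" using brk_anticommute[of e x] by simp
qed

end

section \<open>Polarization over a ring containing one half\<close>

locale polarizable_module = module scl
  for scl :: "'r::comm_ring_1 \<Rightarrow> 'v::ab_group_add \<Rightarrow> 'v" +
  fixes t half :: 'r
  assumes t_cancel: "scl t x = scl t y \<Longrightarrow> x = y"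
    and half_add_half: "half + half = 1"
begin

lemma half_of_double: "scl half (x + x) = x"
  using scale_left_distrib[of half half x] by (simp add: half_add_half scale_right_distrib)

lemma double_cancel:
  fixes x y :: 'v
  assumes "x + x = y + y"
  shows "x = y"
  using arg_cong[OF assms, of "scl half"] by (simp only: half_of_double)

definition polarized :: "('v \<Rightarrow> 'v \<Rightarrow> 'v) \<Rightarrow> ('v \<Rightarrow> 'v \<Rightarrow> 'v) \<Rightarrow> 'v \<Rightarrow> 'v \<Rightarrow> 'v" where
  "polarized mul brk x y = mul x y + scl t (brk x y)"

lemma polarized_bilinear:
  assumes "module_bilinear scl mul" "module_bilinear scl brk"
  shows "module_bilinear scl (polarized mul brk)"
  unfolding module_bilinear_iff[OF module_axioms] polarized_def
  by (simp only: bilinear_simps[OF assms(1)] bilinear_simps[OF assms(2)]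
      scale_right_distrib scale_left_commute[of t] ac_simps simp_thms)

lemma polarized_commutator:
  assumes "LL_algebra scl q mul brk"
  shows "polarized mul brk x y - polarized mul brk y x = scl t (brk x y + brk x y)"
proof -
  interpret LL_algebra scl q mul brk by fact
  show ?thesis
    unfolding polarized_def mul_commute[of y x] brk_anticommute[of y x]
    by (simp only: scale_right_distrib scale_minus_right) simp
qed

lemma polarized_anticommutator:
  assumes "LL_algebra scl q mul brk"
  shows "polarized mul brk x y + polarized mul brk y x = mul x y + mul x y"
proof -
  interpret LL_algebra scl q mul brk by fact
  show ?thesis
    unfolding polarized_def mul_commute[of y x] brk_anticommute[of y x]
    by (simp only: scale_minus_right) simp
qed

lemma polarized_inject:
  assumes LL: "LL_algebra scl q mul brk" "LL_algebra scl q mul' brk'"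
    and eq: "polarized mul brk = polarized mul' brk'"
  shows "mul = mul'" and "brk = brk'"
proof -
  show "mul = mul'"
  proof (intro ext)
    fix x y
    have "mul x y + mul x y = mul' x y + mul' x y"
      using polarized_anticommutator[OF LL(1), of x y] polarized_anticommutator[OF LL(2), of x y]
      by (simp only: eq)
    then show "mul x y = mul' x y"
      by (rule double_cancel)
  qed
  show "brk = brk'"
  proof (intro ext)
    fix x y
    have "scl t (brk x y + brk x y) = scl t (brk' x y + brk' x y)"
      using polarized_commutator[OF LL(1), of x y] polarized_commutator[OF LL(2), of x y]
      by (simp only: eq)
    then show "brk x y = brk' x y"
      by (rule double_cancel[OF t_cancel])
  qed
qed

lemma unit_polarized_iff:
  assumes "LL_algebra scl q mul brk"
  shows "is_unit_elem (polarized mul brk) e \<longleftrightarrow> is_unit_elem mul e"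
proof
  interpret LL_algebra scl q mul brk by fact
  show "is_unit_elem (polarized mul brk) e" if "is_unit_elem mul e"
    using that bracket_with_unit[OF that] by (simp add: is_unit_elem_def polarized_def)
  show "is_unit_elem mul e" if unit: "is_unit_elem (polarized mul brk) e"
  proof -
    have "mul e x = x" for x
    proof (rule double_cancel)
      show "mul e x + mul e x = x + x"
        using polarized_anticommutator[OF assms, of e x] unit by (simp add: is_unit_elem_def)
    qed
    then show ?thesis
      by (metis is_unit_elem_def mul_commute)
  qed
qed

text \<open>
  An associative product whose commutator is divisible by \<open>t\<close> comes from its symmetrization and
  its halved commutator divided by \<open>t\<close>. The Jacobi, Leibniz and associator axioms contain brackets
  only in the combination \<open>t [-,-]\<close> once they are multiplied by \<open>t\<^sup>2\<close>, \<open>t\<close> and \<open>1\<close>, respectively.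
  Both sides then are \<open>1 / 4\<close> times the sides of the corresponding commutator identity.
\<close>

lemma LL_algebra_polarization:
  assumes bilinear: "module_bilinear scl star"
    and assoc: "\<And>x y z. star (star x y) z = star x (star y z)"
    and commute_mod_t: "\<And>x y. \<exists>w. star x y - star y x = scl t w"
  obtains mul brk where "LL_algebra scl (t ^ 2) mul brk" and "polarized mul brk = star"
proof -
  define mul where "mul = (\<lambda>x y. scl half (anticommutator star x y))"
  define c where "c = (\<lambda>x y. scl half (commutator star x y))"
  have mul_bilinear: "module_bilinear scl mul"
    unfolding mul_def by (intro scaled_bilinear anticommutator_bilinear bilinear)
  have c_bilinear: "module_bilinear scl c"
    unfolding c_def by (intro scaled_bilinear commutator_bilinear bilinear)
  have "\<exists>w. scl t w = c x y" for x y
  proof -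
    obtain w where "star x y - star y x = scl t w"
      using commute_mod_t by blast
    then have "scl t (scl half w) = c x y"
      unfolding c_def commutator_def by (simp only: scale_left_commute[of t])
    then show ?thesis ..
  qed
  then obtain brk where t_brk: "scl t (brk x y) = c x y" for x y
    by metis
  \<comment> \<open>The bracket is bilinear because its multiple by \<open>t\<close> is, and \<open>t\<close> can be cancelled.\<close>
  have brk_bilinear: "module_bilinear scl brk"
    unfolding module_bilinear_iff[OF module_axioms]
    by (intro conjI allI; rule t_cancel)
      (simp_all only: t_brk scale_right_distrib scale_left_commute[of t]
        bilinear_simps[OF c_bilinear])
  note comm_scale = bilinear_scale_left[OF commutator_bilinear[OF bilinear]]
    bilinear_scale_right[OF commutator_bilinear[OF bilinear]]
  note anticomm_scale = bilinear_scale_left[OF anticommutator_bilinear[OF bilinear]]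
    bilinear_scale_right[OF anticommutator_bilinear[OF bilinear]]
  have t_t_brk: "scl t (scl t (brk x (brk y z))) =
      scl half (scl half (commutator star x (commutator star y z)))" for x y z
  proof -
    have "scl t (scl t (brk x (brk y z))) = scl t (brk x (scl t (brk y z)))"
      by (simp only: bilinear_scale_right[OF brk_bilinear])
    also have "\<dots> = c x (c y z)"
      by (simp only: t_brk)
    finally show ?thesis
      by (simp only: c_def comm_scale)
  qed
  have "LL_algebra scl (t ^ 2) mul brk"
  proof
    fix x y z
    show "module_bilinear scl mul" and "module_bilinear scl brk" by fact+
    show "mul x y = mul y x"
      by (simp only: mul_def anticommutator_def add.commute)
    show "brk x y = - brk y x"
      by (rule t_cancel)
        (simp only: scale_minus_right t_brk c_def commutator_def scale_right_diff_distrib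
          minus_diff_eq)
    show "brk x (brk y z) + brk y (brk z x) + brk z (brk x y) = 0"
    proof (rule t_cancel, rule t_cancel)
      have "scl t (scl t (brk x (brk y z) + brk y (brk z x) + brk z (brk x y))) =
          scl half (scl half (commutator star x (commutator star y z) +
            commutator star y (commutator star z x) + commutator star z (commutator star x y)))"
        by (simp only: scale_right_distrib t_t_brk)
      then show "scl t (scl t (brk x (brk y z) + brk y (brk z x) + brk z (brk x y))) =
          scl t (scl t 0)"
        by (simp only: commutator_jacobi[OF bilinear assoc] scale_zero_right)
    qed
    show "brk x (mul y z) = mul (brk x y) z + mul y (brk x z)"
    proof (rule t_cancel)
      have "scl t (brk x (mul y z)) = c x (mul y z)"
        by (rule t_brk)
      also have "\<dots> = mul (c x y) z + mul y (c x z)"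
        by (simp only: c_def mul_def comm_scale anticomm_scale
            commutator_derivation[OF bilinear assoc] scale_right_distrib)
      also have "\<dots> = scl t (mul (brk x y) z + mul y (brk x z))"
        by (simp only: t_brk[symmetric] bilinear_scale_right[OF mul_bilinear]
            bilinear_scale_left[OF mul_bilinear] scale_right_distrib)
      finally show "scl t (brk x (mul y z)) = scl t (mul (brk x y) z + mul y (brk x z))" .
    qed
    have "mul (mul x y) z - mul x (mul y z) =
        scl half (scl half (commutator star y (commutator star x z)))"
      by (simp only: mul_def anticomm_scale scale_right_diff_distrib[symmetric]
          anticommutator_associator[OF bilinear assoc])
    then show "mul (mul x y) z - mul x (mul y z) = scl (t ^ 2) (brk y (brk x z))"
      by (simp only: power2_eq_square scale_scale[symmetric] t_t_brk)
  qed
  moreover have "polarized mul brk = star"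
  proof (intro ext)
    fix x y
    have "polarized mul brk x y = scl half (star x y + star x y)"
      by (simp only: polarized_def t_brk mul_def c_def commutator_def anticommutator_def
          scale_right_distrib[symmetric]) simp
    then show "polarized mul brk x y = star x y"
      by (simp add: half_of_double)
  qed
  ultimately show thesis
    using that by blast
qed

end

section \<open>Specialization to formal power series\<close>

lemma fps_scale_X_nth:
  assumes "vector_space scale"
  shows "fps_nth (fps_scale scale fps_X v) n = (if n = 0 then 0 else fps_nth v (n - 1))"
proof -
  interpret vector_space scale by fact
  have "fps_nth (fps_scale scale fps_X v) n =
      (\<Sum>i=0..n. if i = 1 then fps_nth v (n - 1) else 0)"
    unfolding fps_scale_def fps_nth_Abs_fps by (rule sum.cong) auto
  then show ?thesis
    by (auto simp: sum.delta)
qed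

lemma polarizable_module_fps:
  fixes scale :: "'k::field_char_0 \<Rightarrow> 'a::ab_group_add \<Rightarrow> 'a"
  assumes "vector_space scale"
  shows "polarizable_module (fps_scale scale) fps_X (fps_const (1 / 2))"
proof -
  interpret module "fps_scale scale"
    by (rule module_fps_scale) fact
  show ?thesis
  proof
    show "v = w" if eq: "fps_scale scale fps_X v = fps_scale scale fps_X w" for v w
    proof (rule fps_ext)
      fix n
      show "fps_nth v n = fps_nth w n"
        using arg_cong[OF eq, of "\<lambda>u. fps_nth u (Suc n)"]
        by (simp add: fps_scale_X_nth[OF assms])
    qed
    show "fps_const (1 / 2 :: 'k) + fps_const (1 / 2) = 1"
      by simp
  qed
qed

lemma bij_betw_restrict_by_predicate:
  assumes "bij_betw f A B" and "\<And>a. a \<in> A \<Longrightarrow> P a \<longleftrightarrow> Q (f a)"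
  shows "bij_betw f {a \<in> A. P a} {b \<in> B. Q b}"
  using assms by (auto simp: bij_betw_def inj_on_def)

theorem theorem5:
  fixes scale :: "'k::field_char_0 \<Rightarrow> 'a::ab_group_add \<Rightarrow> 'a"
  assumes "vector_space scale"
  shows "bij_betw (depolarize scale)
           {(mul, brk). unital_LL_algebra (fps_scale scale) (fps_X ^ 2) mul brk}
           {star. star_product scale star} \<and>
         bij_betw (depolarize scale)
           {(mul, brk). LL_algebra (fps_scale scale) (fps_X ^ 2) mul brk}
           {star. nonunital_star_product scale star} \<and>
         (\<forall>mul brk e. LL_algebra (fps_scale scale) (fps_X ^ 2) mul brk \<longrightarrow>
           (is_unit_elem mul e \<longleftrightarrow> is_unit_elem (depolarize scale (mul, brk)) e))"
proof -
  interpret polarizable_module "fps_scale scale" fps_X "fps_const (1 / 2 :: 'k)"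
    by (rule polarizable_module_fps) fact
  let ?LL = "{(mul, brk). LL_algebra (fps_scale scale) (fps_X ^ 2) mul brk}"
  let ?stars = "{star. nonunital_star_product scale star}"
  have depolarize: "depolarize scale (mul, brk) = polarized mul brk" for mul brk
    by (simp add: depolarize_def polarized_def fun_eq_iff)
  have star_if_LL: "nonunital_star_product scale (polarized mul brk)"
    if LL: "LL_algebra (fps_scale scale) (fps_X ^ 2) mul brk" for mul brk
  proof -
    interpret LL: LL_algebra "fps_scale scale" "fps_X ^ 2" mul brk by fact
    show ?thesis
      unfolding nonunital_star_product_def nonunital_star_product_axioms_def
      using assms polarized_bilinear[OF LL.mul_bilinear LL.brk_bilinear]
        LL.polarized_product_assoc[OF refl] polarized_commutator[OF LL]
      unfolding polarized_def by blast
  qed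
  have nonunital: "bij_betw (depolarize scale) ?LL ?stars"
  proof (rule bij_betw_imageI)
    show "inj_on (depolarize scale) ?LL"
      by (auto simp: inj_on_def depolarize dest: polarized_inject)
    show "depolarize scale ` ?LL = ?stars"
    proof (intro equalityI subsetI)
      fix star assume "star \<in> ?stars"
      then interpret star: nonunital_star_product scale star by simp
      obtain mul brk where "LL_algebra (fps_scale scale) (fps_X ^ 2) mul brk"
        and "polarized mul brk = star"
        using LL_algebra_polarization[OF star.star_bilinear star.star_assoc star.star_commute_mod_t] by blast
      then show "star \<in> depolarize scale ` ?LL"
        by (auto simp: depolarize intro!: image_eqI[of _ _ "(mul, brk)"])
    qed (auto simp: depolarize star_if_LL)
  qed
  have units: "is_unit_elem mul e \<longleftrightarrow> is_unit_elem (depolarize scale (mul, brk)) e"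
    if "LL_algebra (fps_scale scale) (fps_X ^ 2) mul brk" for mul brk e
    using unit_polarized_iff[OF that] by (simp add: depolarize)
  have "bij_betw (depolarize scale)
      {p \<in> ?LL. \<exists>e. is_unit_elem (fst p) e} {star \<in> ?stars. \<exists>e. is_unit_elem star e}"
    by (rule bij_betw_restrict_by_predicate[OF nonunital]) (auto simp: units)
  moreover have "{p \<in> ?LL. \<exists>e. is_unit_elem (fst p) e} =
      {(mul, brk). unital_LL_algebra (fps_scale scale) (fps_X ^ 2) mul brk}"
    by (auto simp: unital_LL_algebra_def unital_LL_algebra_axioms_def)
  moreover have "{star \<in> ?stars. \<exists>e. is_unit_elem star e} = {star. star_product scale star}"
    by (auto simp: star_product_def star_product_axioms_def)
  ultimately show ?thesis
    using nonunital units by simp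
qed

end
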